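(* Let $\tau\in\mathbb{R}\setminus\{0,-1,-2,\dots\}$ and let $\hat P=P\Delta^{(\tau)}$ be the product of the Pascal matrix and the fractional difference matrix of order $\tau$. For $1\le p<\infty$ with $p\ne 2$, the space $\ell_p(\hat P)$, with the norm $\|x\|_{\ell_p(\hat P)}=\|\hat P x\|_{\ell_p}$, is not a Hilbert space (that is, this norm is not induced by an inner product making the space a Hilbert space).
   Context: $\omega$ denotes the space of all (real or complex) sequences $x=(x_k)_{k\ge 0}$. For real $a$ and integer $m\ge 0$, the expression $\frac{\Gamma(a+1)}{m!\,\Gamma(a-m+1)}$ is understood as the generalized binomial coefficient $\frac{a(a-1)\cdots(a-m+1)}{m!}$ (equal to $1$ for $m=0$). The matrix $\hat P=(\hat p_{nk})_{n,k\ge0}=P\Delta^{(\tau)}$ is lower triangular with $$\hat p_{nk}=\sum_{i=k}^{n}(-1)^{i-k}\binom{n}{n-i}\frac{\Gamma(\tau+1)}{(i-k)!\,\Gamma(\tau-i+k+1)}\quad(0\le k\le n),\qquad \hat p_{nk}=0\quad (k>n).$$ It is the product of the Pascal matrix $P=(\binom{n}{n-k})_{0\le k\le n}$ and the lower triangular matrix $\Delta^{(\tau)}$ with entries $(-1)^{n-k}\frac{\Gamma(\tau+1)}{(n-k)!\,\Gamma(\tau-n+k+1)}$ for $0\le k\le n$. For $x\in\omega$, $(\hat P x)_n=\sum_{k=0}^n\hat p_{nk}x_k$. For $1\le p<\infty$, $\ell_p(\hat P)=\{x\in\omega:\hat P x\in\ell_p\}$. *)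

theory Defs
  imports "HOL-Analysis.Analysis" "HOL-Library.Function_Algebras"
begin

definition pascal :: "nat \<Rightarrow> nat \<Rightarrow> real" where
  "pascal n k = (if k \<le> n then real (n choose (n - k)) else 0)"

text \<open>
  The quotient \<open>\<Gamma>(\<tau> + 1) / (m! \<Gamma>(\<tau> - m + 1))\<close> is read as the generalized binomial
  coefficient \<open>\<tau> (\<tau> - 1) \<dots> (\<tau> - m + 1) / m!\<close>, i.e. \<open>\<tau> gchoose m\<close>; the Gamma expression
  itself would go wrong at the poles.
\<close>

definition frac_diff :: "real \<Rightarrow> nat \<Rightarrow> nat \<Rightarrow> real" where
  "frac_diff \<tau> n k = (if k \<le> n then (-1) ^ (n - k) * (\<tau> gchoose (n - k)) else 0)"

text \<open>The matrix product; as both factors are lower triangular, only \<open>k \<le> i \<le> n\<close> contributes.\<close>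

definition phat :: "real \<Rightarrow> nat \<Rightarrow> nat \<Rightarrow> real" where
  "phat \<tau> n k = (\<Sum>i=k..n. pascal n i * frac_diff \<tau> i k)"

lemma phat_eq:
  "phat \<tau> n k =
    (if k \<le> n then \<Sum>i=k..n. (-1) ^ (i - k) * real (n choose (n - i)) * (\<tau> gchoose (i - k)) else 0)"
  by (auto simp: phat_def pascal_def frac_diff_def mult_ac intro!: sum.cong)

text \<open>
  Sequences have values in \<open>'a\<close>, which is instantiated to \<^typ>\<open>real\<close> and \<^typ>\<open>complex\<close>.
\<close>

definition phat_seq :: "real \<Rightarrow> (nat \<Rightarrow> 'a) \<Rightarrow> nat \<Rightarrow> 'a::real_normed_field" where
  "phat_seq \<tau> x n = (\<Sum>k\<le>n. of_real (phat \<tau> n k) * x k)"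

definition lp_space :: "real \<Rightarrow> (nat \<Rightarrow> 'a::real_normed_field) set" where
  "lp_space p = {x. summable (\<lambda>k. norm (x k) powr p)}"

definition lp_norm :: "real \<Rightarrow> (nat \<Rightarrow> 'a::real_normed_field) \<Rightarrow> real" where
  "lp_norm p x = (\<Sum>k. norm (x k) powr p) powr (1 / p)"

definition lp_phat :: "real \<Rightarrow> real \<Rightarrow> (nat \<Rightarrow> 'a::real_normed_field) set" where
  "lp_phat \<tau> p = {x. phat_seq \<tau> x \<in> lp_space p}"

definition lp_phat_norm :: "real \<Rightarrow> real \<Rightarrow> (nat \<Rightarrow> 'a::real_normed_field) \<Rightarrow> real" where
  "lp_phat_norm \<tau> p x = lp_norm p (phat_seq \<tau> x)"

definition seq_scale :: "'a::real_normed_field \<Rightarrow> (nat \<Rightarrow> 'a) \<Rightarrow> nat \<Rightarrow> 'a" where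
  "seq_scale c x = (\<lambda>k. c * x k)"

text \<open>
  The parameter \<open>cj\<close> is the conjugation of the scalar field: the identity for \<^typ>\<open>real\<close> and
  \<^const>\<open>cnj\<close> for \<^typ>\<open>complex\<close>. Linearity is in the first argument.
\<close>

definition inner_product_on ::
  "('a \<Rightarrow> 'a) \<Rightarrow> (nat \<Rightarrow> 'a::real_normed_field) set \<Rightarrow> ((nat \<Rightarrow> 'a) \<Rightarrow> (nat \<Rightarrow> 'a) \<Rightarrow> 'a) \<Rightarrow> bool"
  where
  "inner_product_on cj V ip \<longleftrightarrow>
    (\<forall>x\<in>V. \<forall>y\<in>V. \<forall>z\<in>V. ip (x + y) z = ip x z + ip y z) \<and>
    (\<forall>c. \<forall>x\<in>V. \<forall>y\<in>V. ip (seq_scale c x) y = c * ip x y) \<and>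
    (\<forall>x\<in>V. \<forall>y\<in>V. ip y x = cj (ip x y)) \<and>
    (\<forall>x\<in>V. ip x x \<in> \<real>\<^sub>\<ge>\<^sub>0) \<and>
    (\<forall>x\<in>V. ip x x = 0 \<longrightarrow> x = 0)"

text \<open>
  \<open>V\<close> with the norm \<open>N\<close> is a Hilbert space: \<open>N\<close> is induced by an inner product on the linear
  space \<open>V\<close>, and \<open>V\<close> is complete in the metric of \<open>N\<close>. As \<open>ip x x\<close> is a nonnegative real,
  \<open>norm (ip x x)\<close> is \<open>ip x x\<close> itself, as a real number.
\<close>

definition hilbert_space_on ::
  "('a \<Rightarrow> 'a) \<Rightarrow> (nat \<Rightarrow> 'a::real_normed_field) set \<Rightarrow> ((nat \<Rightarrow> 'a) \<Rightarrow> real) \<Rightarrow> bool" where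
  "hilbert_space_on cj V N \<longleftrightarrow>
    module.subspace seq_scale V \<and>
    (\<exists>ip. inner_product_on cj V ip \<and> (\<forall>x\<in>V. N x = sqrt (norm (ip x x)))) \<and>
    Metric_space.mcomplete V (\<lambda>x y. N (x - y))"

text \<open>The linear-space requirement does hold for \<^term>\<open>lp_phat \<tau> p\<close>.\<close>

interpretation seq_scale: module "seq_scale :: 'a::real_normed_field \<Rightarrow> _"
  by unfold_locales (auto simp: seq_scale_def fun_eq_iff algebra_simps)

lemma phat_seq_add: "phat_seq \<tau> (x + y) = phat_seq \<tau> x + phat_seq \<tau> y"
  by (auto simp: phat_seq_def fun_eq_iff algebra_simps sum.distrib)

lemma phat_seq_scale: "phat_seq \<tau> (seq_scale c x) = seq_scale c (phat_seq \<tau> x)"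
  by (auto simp: phat_seq_def seq_scale_def fun_eq_iff sum_distrib_left mult_ac)

lemma subspace_lp_space:
  assumes "p \<ge> 1"
  shows "module.subspace seq_scale (lp_space p :: (nat \<Rightarrow> 'a::real_normed_field) set)"
proof (rule seq_scale.subspaceI)
  show "0 \<in> (lp_space p :: (nat \<Rightarrow> 'a) set)"
    by (simp add: lp_space_def)
next
  fix x y :: "nat \<Rightarrow> 'a"
  assume "x \<in> lp_space p" "y \<in> lp_space p"
  then have "summable (\<lambda>k. 2 powr p * (norm (x k) powr p + norm (y k) powr p))"
    by (auto simp: lp_space_def intro!: summable_mult summable_add)
  then have "summable (\<lambda>k. norm (x k + y k) powr p)"
  proof (rule summable_comparison_test'[where N = 0])
    fix k
    have "norm (x k + y k) \<le> 2 * max (norm (x k)) (norm (y k))"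
      using norm_triangle_ineq[of "x k" "y k"] by linarith
    then have "norm (x k + y k) powr p \<le> (2 * max (norm (x k)) (norm (y k))) powr p"
      using assms by (intro powr_mono2) auto
    also have "\<dots> = 2 powr p * max (norm (x k)) (norm (y k)) powr p"
      by (simp add: powr_mult)
    also have "\<dots> \<le> 2 powr p * (norm (x k) powr p + norm (y k) powr p)"
      by (intro mult_left_mono) (auto simp: max_def)
    finally show "norm (norm (x k + y k) powr p) \<le> 2 powr p * (norm (x k) powr p + norm (y k) powr p)"
      by simp
  qed
  then show "x + y \<in> lp_space p"
    by (simp add: lp_space_def)
next
  fix c :: 'a and x :: "nat \<Rightarrow> 'a"
  assume "x \<in> lp_space p"
  then show "seq_scale c x \<in> lp_space p"
    by (simp add: lp_space_def seq_scale_def norm_mult powr_mult summable_mult)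
qed

lemma subspace_lp_phat:
  assumes "p \<ge> 1"
  shows "module.subspace seq_scale (lp_phat \<tau> p :: (nat \<Rightarrow> 'a::real_normed_field) set)"
proof (rule seq_scale.subspaceI)
  have "phat_seq \<tau> 0 = (0 :: nat \<Rightarrow> 'a)"
    by (simp add: phat_seq_def fun_eq_iff)
  then show "0 \<in> (lp_phat \<tau> p :: (nat \<Rightarrow> 'a) set)"
    using seq_scale.subspace_0[OF subspace_lp_space[OF assms]] by (simp add: lp_phat_def)
qed (use subspace_lp_space[OF assms] in
      \<open>auto simp: lp_phat_def phat_seq_add phat_seq_scale
        intro: seq_scale.subspace_add seq_scale.subspace_scale\<close>)

end

theory Submission
  imports Defs
begin

text \<open>
  The matrix \<open>phat \<tau>\<close> is lower triangular with unit diagonal, so every sequence has a preimage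
  under it. Preimages of the first two unit sequences violate the parallelogram law unless
  \<open>2 powr (2 / p) = 2\<close>, that is \<open>p = 2\<close>.
\<close>

lemma phat_diag: "phat \<tau> n n = 1"
  by (simp add: phat_def pascal_def frac_diff_def)

text \<open>Forward substitution for the triangular system with matrix \<open>phat \<tau>\<close>;
  as the diagonal entries are 1, no division occurs. The equation is kept out of the simp set
  because its right-hand side could be unfolded forever.\<close>

fun phat_solve :: "real \<Rightarrow> (nat \<Rightarrow> 'a::real_normed_field) \<Rightarrow> nat \<Rightarrow> 'a" where
  "phat_solve \<tau> y n = y n - (\<Sum>k<n. of_real (phat \<tau> n k) * phat_solve \<tau> y k)"

declare phat_solve.simps [simp del]

lemma phat_seq_phat_solve: "phat_seq \<tau> (phat_solve \<tau> y) = y"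
proof
  fix n
  have "phat_seq \<tau> (phat_solve \<tau> y) n =
      (\<Sum>k<n. of_real (phat \<tau> n k) * phat_solve \<tau> y k) + phat_solve \<tau> y n"
    by (simp add: phat_seq_def phat_diag flip: lessThan_Suc_atMost)
  then show "phat_seq \<tau> (phat_solve \<tau> y) n = y n"
    by (simp add: phat_solve.simps[of \<tau> y n])
qed

text \<open>Keeping \<open>cj\<close> abstract, with additivity assumed, covers the real and the
  complex case at once.\<close>

lemma parallelogram_inner_product_on:
  assumes ip: "inner_product_on cj V ip"
    and cj: "\<And>a b. cj (a + b) = cj a + cj b"
    and N: "\<And>x. x \<in> V \<Longrightarrow> N x = sqrt (norm (ip x x))"
    and V: "module.subspace seq_scale V"
    and x: "x \<in> V" and y: "y \<in> V"
  shows "(N (x + y))\<^sup>2 + (N (x - y))\<^sup>2 = 2 * (N x)\<^sup>2 + 2 * (N y)\<^sup>2"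
proof -
  note ip = ip[unfolded inner_product_on_def]
  note add_left = ip[THEN conjunct1, rule_format]
  note herm = ip[THEN conjunct2, THEN conjunct2, THEN conjunct1, rule_format]
  note nonneg = ip[THEN conjunct2, THEN conjunct2, THEN conjunct2, THEN conjunct1, rule_format]
  have mem: "x + y \<in> V" "x - y \<in> V"
    using V x y by (auto intro: seq_scale.subspace_add seq_scale.subspace_diff)
  \<comment> \<open>Hermitian symmetry moves the sum into the first argument, and additivity of
    \<open>cj\<close> brings the result back.\<close>
  have add_right: "ip w (u + v) = ip w u + ip w v" if "u \<in> V" "v \<in> V" "w \<in> V" for u v w
    using herm[of "u + v" w] herm[of u w] herm[of v w] that
    by (simp add: add_left cj seq_scale.subspace_add[OF V])
  \<comment> \<open>Additivity applied to u = (u - v) + v.\<close>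
  have diff_left: "ip (u - v) w = ip u w - ip v w" if "u \<in> V" "v \<in> V" "w \<in> V" for u v w
    using add_left[of "u - v" v w] that seq_scale.subspace_diff[OF V, of u v] by simp
  have diff_right: "ip w (u - v) = ip w u - ip w v" if "u \<in> V" "v \<in> V" "w \<in> V" for u v w
    using add_right[of "u - v" v w] that seq_scale.subspace_diff[OF V, of u v] by simp
  \<comment> \<open>\<open>N\<close> is real but \<open>ip\<close> takes values in the scalar field,
    so the identity is proved there and pulled back along the injective
    \<open>of_real\<close>.\<close>
  have N2: "of_real ((N u)\<^sup>2) = ip u u" if u: "u \<in> V" for u
  proof -
    obtain r where "r \<ge> 0" "ip u u = of_real r"
      using nonneg[OF u] by (auto elim: nonneg_Reals_cases)
    then show ?thesis
      using N[OF u] by simp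
  qed
  \<comment> \<open>The cross terms \<open>ip x y\<close> and \<open>ip y x\<close> cancel.\<close>
  have "ip (x + y) (x + y) + ip (x - y) (x - y) = 2 * ip x x + 2 * ip y y"
    by (simp add: add_left add_right diff_left diff_right mem x y)
  then have "of_real ((N (x + y))\<^sup>2 + (N (x - y))\<^sup>2) = (of_real (2 * (N x)\<^sup>2 + 2 * (N y)\<^sup>2) :: 'a)"
    by (simp only: of_real_add of_real_mult of_real_numeral N2 mem x y)
  then show ?thesis
    by (simp only: of_real_eq_iff)
qed

lemma
  fixes z :: "nat \<Rightarrow> 'a::real_normed_field"
  assumes "\<And>k. k \<ge> 2 \<Longrightarrow> z k = 0"
  shows lp_space_first_two: "z \<in> lp_space p"
    and lp_norm_first_two: "lp_norm p z = (norm (z 0) powr p + norm (z 1) powr p) powr (1 / p)"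
proof -
  \<comment> \<open>All terms from index 2 on vanish, since \<open>0 powr p = 0\<close> whatever p
    is.\<close>
  have "(\<lambda>k. norm (z k) powr p) sums (\<Sum>k\<in>{0, 1}. norm (z k) powr p)"
    by (rule sums_finite) (auto intro!: assms)
  then show "z \<in> lp_space p"
    and "lp_norm p z = (norm (z 0) powr p + norm (z 1) powr p) powr (1 / p)"
    by (auto simp: lp_space_def lp_norm_def sums_iff)
qed

lemma not_hilbert_space_on_lp_phat:
  fixes cj :: "'a::real_normed_field \<Rightarrow> 'a"
  assumes cj: "\<And>a b. cj (a + b) = cj a + cj b" and p: "1 \<le> p" "p \<noteq> 2"
  shows "\<not> hilbert_space_on cj (lp_phat \<tau> p) (lp_phat_norm \<tau> p)"
proof
  assume "hilbert_space_on cj (lp_phat \<tau> p) (lp_phat_norm \<tau> p)"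
  then obtain ip where V: "module.subspace seq_scale (lp_phat \<tau> p :: (nat \<Rightarrow> 'a) set)"
    and ip: "inner_product_on cj (lp_phat \<tau> p) ip"
    and N: "\<And>x. x \<in> lp_phat \<tau> p \<Longrightarrow> lp_phat_norm \<tau> p x = sqrt (norm (ip x x))"
    unfolding hilbert_space_on_def by blast
  define e where "e i k = (if k = i then 1 else 0 :: 'a)" for i k :: nat
  define x where "x = phat_solve \<tau> (e 0)"
  define y where "y = phat_solve \<tau> (e 1)"
  have x: "phat_seq \<tau> x = e 0" and y: "phat_seq \<tau> y = e 1"
    by (simp_all add: x_def y_def phat_seq_phat_solve)
  \<comment> \<open>Additivity on x = (x - y) + y spares a separate rule for differences.\<close>
  have xy: "phat_seq \<tau> (x - y) = e 0 - e 1"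
    using phat_seq_add[of \<tau> "x - y" y] x y by (simp add: algebra_simps)
  have "x \<in> lp_phat \<tau> p" "y \<in> lp_phat \<tau> p"
    by (auto simp: lp_phat_def x y e_def intro!: lp_space_first_two)
  from parallelogram_inner_product_on[where cj = cj and ip = ip and N = "lp_phat_norm \<tau> p", OF ip cj N V this]
  have "(lp_norm p (e 0 + e 1))\<^sup>2 + (lp_norm p (e 0 - e 1))\<^sup>2 =
      2 * (lp_norm p (e 0))\<^sup>2 + 2 * (lp_norm p (e 1))\<^sup>2"
    by (simp add: lp_phat_norm_def x y xy phat_seq_add)
  \<comment> \<open>Both \<open>e 0 + e 1\<close> and \<open>e 0 - e 1\<close> have exactly two
    nonzero entries, each of norm 1, so the law reads 2 * (2 powr (1 / p))^2 = 4.\<close>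
  moreover have "lp_norm p (e 0) = 1" "lp_norm p (e 1) = 1"
    "lp_norm p (e 0 + e 1) = 2 powr (1 / p)" "lp_norm p (e 0 - e 1) = 2 powr (1 / p)"
    by (subst lp_norm_first_two; simp add: e_def)+
  ultimately have "(2 powr (1 / p))\<^sup>2 = (2 :: real)"
    by simp
  then have "2 powr (2 / p) = (2 powr 1 :: real)"
    by (simp add: power2_eq_square flip: powr_add)
  then have "2 / p = 1"
    by (subst (asm) powr_inj) auto
  then show False
    using p by simp
qed

theorem theorem3p3:
  fixes \<tau> p :: real
  assumes "\<tau> \<notin> \<int>\<^sub>\<le>\<^sub>0"
    and "1 \<le> p"
    and "p \<noteq> 2"
  shows "\<not> hilbert_space_on (\<lambda>c. c) (lp_phat \<tau> p :: (nat \<Rightarrow> real) set) (lp_phat_norm \<tau> p) \<and>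
         \<not> hilbert_space_on cnj (lp_phat \<tau> p :: (nat \<Rightarrow> complex) set) (lp_phat_norm \<tau> p)"
  using assms by (intro conjI not_hilbert_space_on_lp_phat) auto

end
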